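(* Let $(\theta,\varphi)$ be a synchronizing Markov random dynamical system (RDS) over a probability space $(\Omega,\mathcal F,\mathbb P)$ on a countable state space $\mathbb X$, representing an irreducible and positive recurrent Markov chain. For $x,y\in\mathbb X$ let $$T_\Delta(\omega,x,y):=\min\{n\in\mathbb N \mid \varphi^n_\omega(x)=\varphi^n_\omega(y)\}$$ be the synchronization time. Then for any $x,y\in\mathbb X$ the expected synchronization time is finite, i.e. $$\mathbb E[T_\Delta(\omega,x,y)]<\infty.$$
   Context: $\mathbb N$ includes $0$. $\mathbb X$ is countable, with the power set $\sigma$-algebra $\mathcal P(\mathbb X)$. Expectations are with respect to $\mathbb P$ over $\omega$. RDS: An RDS $(\theta,\varphi)$ on $\mathbb X$ consists of a probability space $(\Omega,\mathcal F,\mathbb P)$; a group $(\theta_n)_{n\in\mathbb Z}$ of bimeasurable measure-preserving maps $\theta_n:\Omega\to\Omega$ with $\theta_0=\mathrm{id}$, $\theta_{n+m}=\theta_n\circ\theta_m$, where $\theta:=\theta_1$ is assumed ergodic with respect to $\mathbb P$; and an $(\mathcal F\otimes\mathcal P(\mathbb N)\otimes\mathcal P(\mathbb X))$-measurable map $\varphi:\Omega\times\mathbb N\times\mathbb X\to\mathbb X$, $(\omega,n,x)\mapsto\varphi^n_\omega(x)$, with $\varphi^0_\omega(x)=x$ and $\varphi^{n+m}_\omega(x)=\varphi^n_{\theta_m\omega}(\varphi^m_\omega(x))$ for all $\omega\in\Omega$, $m,n\in\mathbb N$, $x\in\mathbb X$. Write $\varphi_\omega:=\varphi^1_\omega$.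 Markov RDS: for $s<t$ in $\mathbb Z$, $\mathcal F_s^t\subset\mathcal F$ is the $\sigma$-algebra generated by the $\mathbb P$-null sets of $\mathcal F$ and the random variables $\omega\mapsto\varphi^n_{\theta_m\omega}(x)$ for $x\in\mathbb X$ and integers $m,n$ with $s\le m\le m+n\le t$. $\mathcal F_{-\infty}^t:=\sigma(\mathcal F_s^t: s<t)$, $\mathcal F_s^\infty:=\sigma(\mathcal F_s^t: t>s)$. The RDS is Markov if $\mathcal F_{-\infty}^0$ and $\mathcal F_0^\infty$ are independent. Then $X_n(\omega)=\varphi^n_\omega(x)$ is a time-homogeneous Markov chain with transition probabilities $P(x,y)=\mathbb P(\varphi_\omega(x)=y)$; the RDS is said to represent this (associated) Markov chain. Synchronizing: $x,y\in\mathbb X$ $\omega$-synchronize if there is $n\in\mathbb N$ with $\varphi^n_\omega(x)=\varphi^n_\omega(y)$. The RDS is synchronizing if any $x,y\in\mathbb X$ $\omega$-synchronize for $\mathbb P$-a.e. $\omega\in\Omega$. *)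

theory Defs
  imports "HOL-Probability.Probability"
begin

definition measure_preserving_map :: "'w measure \<Rightarrow> ('w \<Rightarrow> 'w) \<Rightarrow> bool" where
  "measure_preserving_map M T \<longleftrightarrow> T \<in> measurable M M \<and> distr M M T = M"

definition ergodic_map :: "'w measure \<Rightarrow> ('w \<Rightarrow> 'w) \<Rightarrow> bool" where
  "ergodic_map M T \<longleftrightarrow> measure_preserving_map M T \<and>
     (\<forall>A\<in>sets M. T -` A \<inter> space M = A \<longrightarrow> measure M A = 0 \<or> measure M A = 1)"

text \<open>
  The state space is a countable type with its power set sigma-algebra, and \<open>\<phi> n \<omega> x\<close> stands
  for $\varphi^n_\omega(x)$. Every \<open>\<theta> n\<close> is bimeasurable, since its inverse on \<open>space M\<close> is the
  measurable map \<open>\<theta> (- n)\<close>.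
\<close>

locale random_dynamical_system = prob_space M
  for M :: "'w measure" +
  fixes \<theta> :: "int \<Rightarrow> 'w \<Rightarrow> 'w"
    and \<phi> :: "nat \<Rightarrow> 'w \<Rightarrow> 'x::countable \<Rightarrow> 'x"
  assumes theta_preserving: "\<And>n. measure_preserving_map M (\<theta> n)"
    and theta_zero: "\<And>\<omega>. \<omega> \<in> space M \<Longrightarrow> \<theta> 0 \<omega> = \<omega>"
    and theta_add: "\<And>n m \<omega>. \<omega> \<in> space M \<Longrightarrow> \<theta> (n + m) \<omega> = \<theta> n (\<theta> m \<omega>)"
    and theta_ergodic: "ergodic_map M (\<theta> 1)"
    and phi_measurable:
      "(\<lambda>(\<omega>, n, x). \<phi> n \<omega> x)
         \<in> measurable (M \<Otimes>\<^sub>M (count_space UNIV \<Otimes>\<^sub>M count_space UNIV)) (count_space UNIV)"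
    and phi_zero: "\<And>\<omega> x. \<omega> \<in> space M \<Longrightarrow> \<phi> 0 \<omega> x = x"
    and phi_cocycle:
      "\<And>\<omega> n m x. \<omega> \<in> space M \<Longrightarrow> \<phi> (n + m) \<omega> x = \<phi> n (\<theta> (int m) \<omega>) (\<phi> m \<omega> x)"
begin

text \<open>The sigma-algebras $\mathcal F_s^t$, $\mathcal F_{-\infty}^t$ and $\mathcal F_s^\infty$.\<close>

definition F_between :: "int \<Rightarrow> int \<Rightarrow> 'w set set" where
  "F_between s t = sigma_sets (space M)
     (null_sets M \<union>
      {(\<lambda>\<omega>. \<phi> n (\<theta> m \<omega>) x) -` B \<inter> space M | m n x B. s \<le> m \<and> m + int n \<le> t})"

definition F_until :: "int \<Rightarrow> 'w set set" where
  "F_until t = sigma_sets (space M) (\<Union>s\<in>{..<t}. F_between s t)"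

definition F_from :: "int \<Rightarrow> 'w set set" where
  "F_from s = sigma_sets (space M) (\<Union>t\<in>{s<..}. F_between s t)"

definition markov :: bool where
  "markov \<longleftrightarrow> indep_set (F_until 0) (F_from 0)"

definition synchronizing :: bool where
  "synchronizing \<longleftrightarrow> (\<forall>x y. AE \<omega> in M. \<exists>n. \<phi> n \<omega> x = \<phi> n \<omega> y)"

text \<open>
  The Markov chain represented by a Markov RDS: \<open>chain x n\<close> is its position at time \<open>n\<close> when
  started in \<open>x\<close>. Its irreducibility and positive recurrence are stated for the chains started
  in the individual states.
\<close>

definition chain :: "'x \<Rightarrow> nat \<Rightarrow> 'w \<Rightarrow> 'x" where
  "chain x n \<omega> = \<phi> n \<omega> x"

definition irreducible_chain :: bool where
  "irreducible_chain \<longleftrightarrow> (\<forall>x y. \<exists>n. prob {\<omega> \<in> space M. chain x n \<omega> = y} > 0)"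

text \<open>
  \<open>Inf {} = \<infinity>\<close> in \<^typ>\<open>enat\<close>, so both times below are infinite where the event never occurs; a
  finite expectation therefore entails that they are almost surely finite.
\<close>

definition return_time :: "'x \<Rightarrow> 'w \<Rightarrow> enat" where
  "return_time x \<omega> = Inf {enat n | n. n \<ge> 1 \<and> chain x n \<omega> = x}"

definition positive_recurrent_chain :: bool where
  "positive_recurrent_chain \<longleftrightarrow>
     (\<forall>x. (\<integral>\<^sup>+ \<omega>. ennreal_of_enat (return_time x \<omega>) \<partial>M) < \<infinity>)"

definition synchronization_time :: "'w \<Rightarrow> 'x \<Rightarrow> 'x \<Rightarrow> enat" where
  "synchronization_time \<omega> x y = Inf {enat n | n. \<phi> n \<omega> x = \<phi> n \<omega> y}"

end

end

theory Submission
  imports Defs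
begin

text \<open>
  Fix a state \<open>z\<close>. Some finite set \<open>F\<close> carries more than half of the stationary mass, so two
  trajectories have to be in \<open>F\<close> at the same time for a positive fraction of the time: with \<open>c < 2\<close> the inverse of
  the mass of \<open>F\<close>, a nonnegative solution \<open>V\<close> of the Poisson equation \<open>P V = V - 1 + c 1\<^sub>F\<close>
  yields the Lyapunov function \<open>V x + V y\<close> of the two-point motion, with drift at most
  \<open>- (2 - c) + c 1\<^bsub>F \<times> F\<^esub>\<close>. Hence the expected synchronization time is bounded by a multiple
  of the expected number of visits to \<open>F \<times> F\<close> before synchronization. That number is finite
  because from each of the finitely many pairs in \<open>F \<times> F\<close> synchronization has positive
  probability within a bounded time.
\<close>

section \<open>Tails of discrete waiting times and decomposition over countably many values\<close>

lemma Inf_enat_greater_iff: "enat n < Inf {enat k | k. P k} \<longleftrightarrow> (\<forall>k\<le>n. \<not> P k)"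
proof -
  have "enat n < Inf {enat k | k. P k} \<longleftrightarrow> enat (Suc n) \<le> Inf {enat k | k. P k}"
    by (simp only: Suc_ile_eq)
  also have "\<dots> \<longleftrightarrow> (\<forall>k. P k \<longrightarrow> Suc n \<le> k)"
    by (auto simp: le_Inf_iff)
  finally show ?thesis
    by (auto simp: not_le Suc_le_eq)
qed

lemma measurable_Inf_enat:
  assumes [measurable]: "\<And>k. Measurable.pred N (P k)"
  shows "(\<lambda>\<omega>. Inf {enat k | k. P k \<omega>}) \<in> N \<rightarrow>\<^sub>M count_space UNIV"
proof -
  have "Inf {enat k | k. P k \<omega>} = (INF k. if P k \<omega> then enat k else \<top>)" for \<omega>
  proof (rule antisym)
    show "Inf {enat k | k. P k \<omega>} \<le> (INF k. if P k \<omega> then enat k else \<top>)"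
      by (rule INF_greatest) (auto intro: Inf_lower)
    show "(INF k. if P k \<omega> then enat k else \<top>) \<le> Inf {enat k | k. P k \<omega>}"
    proof (rule Inf_greatest)
      fix t assume "t \<in> {enat k | k. P k \<omega>}"
      then obtain k where "t = enat k" "P k \<omega>"
        by blast
      then show "(INF k. if P k \<omega> then enat k else \<top>) \<le> t"
        by (intro INF_lower2[of k]) simp_all
    qed
  qed
  then show ?thesis
    by (simp only:) measurable
qed

lemma half_less_ennreal:
  fixes x :: ennreal
  assumes "x \<noteq> 0" "x < \<top>"
  shows "x / 2 < x"
proof (cases x)
  case (real r)
  then have "x / 2 = ennreal (r / 2)"
    by (simp add: divide_ennreal flip: ennreal_numeral)
  then show ?thesis
    using real assms by (simp add: ennreal_less_iff)
qed (use assms in simp)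

text \<open>Freezes the state reached after one step, so that independence can be applied for one
  fixed state at a time. Countability turns the decomposition into a sum that can be exchanged with
  the integral.\<close>

lemma (in sigma_finite_measure) nn_integral_split_value:
  fixes Z :: "'a \<Rightarrow> 's::countable" and f :: "'s \<Rightarrow> 'a \<Rightarrow> ennreal"
  assumes [measurable]: "Z \<in> M \<rightarrow>\<^sub>M count_space UNIV" "\<And>s. f s \<in> borel_measurable M"
  shows "(\<integral>\<^sup>+\<omega>. f (Z \<omega>) \<omega> \<partial>M)
    = (\<integral>\<^sup>+s. (\<integral>\<^sup>+\<omega>. f s \<omega> * indicator {s} (Z \<omega>) \<partial>M) \<partial>count_space UNIV)"
proof -
  have "f (Z \<omega>) \<omega> = (\<integral>\<^sup>+s. f s \<omega> * indicator {s} (Z \<omega>) \<partial>count_space UNIV)" for \<omega>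
  proof -
    have "(\<integral>\<^sup>+s. f s \<omega> * indicator {s} (Z \<omega>) \<partial>count_space UNIV)
        = (\<integral>\<^sup>+s. f (Z \<omega>) \<omega> * indicator {Z \<omega>} s \<partial>count_space UNIV)"
      by (intro nn_integral_cong) (auto simp: indicator_def)
    then show ?thesis
      by simp
  qed
  then have "(\<integral>\<^sup>+\<omega>. f (Z \<omega>) \<omega> \<partial>M)
      = (\<integral>\<^sup>+\<omega>. (\<integral>\<^sup>+s. f s \<omega> * indicator {s} (Z \<omega>) \<partial>count_space UNIV) \<partial>M)"
    by simp
  also have "\<dots> = (\<integral>\<^sup>+s. (\<integral>\<^sup>+\<omega>. f s \<omega> * indicator {s} (Z \<omega>) \<partial>M) \<partial>count_space UNIV)"
    by (rule nn_integral_count_space_nn_integral) auto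
  finally show ?thesis .
qed

section \<open>Killed transition operators and their occupation sums\<close>

locale random_map = prob_space M for M :: "'w measure" +
  fixes g :: "'w \<Rightarrow> 's::countable \<Rightarrow> 's"
  assumes measurable_map[measurable]: "\<And>s. (\<lambda>\<omega>. g \<omega> s) \<in> M \<rightarrow>\<^sub>M count_space UNIV"
begin

text \<open>
  Transition operator of the chain killed on entering \<open>D\<close> at a positive time; starting inside \<open>D\<close>
  is allowed.
\<close>

definition killed :: "'s set \<Rightarrow> ('s \<Rightarrow> ennreal) \<Rightarrow> 's \<Rightarrow> ennreal" where
  "killed D f s = (\<integral>\<^sup>+\<omega>. f (g \<omega> s) * indicator (- D) (g \<omega> s) \<partial>M)"

text \<open>The Green operator of the killed chain: the expected sum of \<open>f\<close> over the
  times before killing. Time 0 counts even for a start in \<open>D\<close>, so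
  \<open>occupation {z} (\<lambda>_. 1) z\<close> is the mean return time to \<open>z\<close> and
  not zero.\<close>

definition occupation :: "'s set \<Rightarrow> ('s \<Rightarrow> ennreal) \<Rightarrow> 's \<Rightarrow> ennreal" where
  "occupation D f s = (\<Sum>n. (killed D ^^ n) f s)"

abbreviation survival :: "'s set \<Rightarrow> nat \<Rightarrow> 's \<Rightarrow> ennreal" where
  "survival D n \<equiv> (killed D ^^ n) (\<lambda>_. 1)"

lemma killed_mono: "(\<And>s. f s \<le> h s) \<Longrightarrow> killed D f s \<le> killed D h s"
  unfolding killed_def by (intro nn_integral_mono mult_right_mono) auto

lemma killed_add: "killed D (\<lambda>s. f s + h s) = (\<lambda>s. killed D f s + killed D h s)"
  by (rule ext) (simp add: killed_def distrib_right nn_integral_add)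

lemma killed_cmult: "killed D (\<lambda>s. c * f s) = (\<lambda>s. c * killed D f s)"
  by (rule ext) (simp add: killed_def mult.assoc nn_integral_cmult)

lemma killed_suminf: "killed D (\<lambda>s. \<Sum>n. f n s) = (\<lambda>s. \<Sum>n. killed D (f n) s)"
  by (rule ext) (simp add: killed_def nn_integral_suminf flip: ennreal_suminf_multc)

lemma killed_SUP:
  assumes "incseq f"
  shows "killed D (\<lambda>s. SUP n. f n s) = (\<lambda>s. SUP n. killed D (f n) s)"
proof
  fix s
  have "incseq (\<lambda>n \<omega>. f n (g \<omega> s) * indicator (- D) (g \<omega> s))"
    using assms by (auto simp: mono_def le_fun_def intro!: mult_right_mono)
  then show "killed D (\<lambda>s. SUP n. f n s) s = (SUP n. killed D (f n) s)"
    by (simp add: killed_def SUP_mult_right_ennreal flip: nn_integral_monotone_convergence_SUP)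
qed

lemma killed_one_le: "killed D (\<lambda>_. 1) s \<le> 1"
proof -
  have "killed D (\<lambda>_. 1) s \<le> (\<integral>\<^sup>+\<omega>. 1 \<partial>M)"
    unfolding killed_def by (intro nn_integral_mono) (auto simp: indicator_def)
  then show ?thesis
    by (simp add: emeasure_space_1)
qed

lemma killed_empty_const: "killed {} (\<lambda>_. c) s = c"
  by (simp add: killed_def emeasure_space_1)

text \<open>Compares the free chain with the one killed at \<open>z\<close>: they differ only by the
  mass that arrives in \<open>z\<close>.\<close>

lemma killed_empty_split:
  "killed {} f s = killed {z} f s + killed {} (indicator {z}) s * f z"
proof -
  have "killed {} f s
      = (\<integral>\<^sup>+\<omega>. f (g \<omega> s) * indicator (- {z}) (g \<omega> s) + f z * indicator {z} (g \<omega> s) \<partial>M)"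
    unfolding killed_def by (intro nn_integral_cong) (auto simp: indicator_def)
  then show ?thesis
    by (simp add: killed_def nn_integral_add nn_integral_cmult mult.commute)
qed

lemma iter_mono: "(\<And>s. f s \<le> h s) \<Longrightarrow> (killed D ^^ n) f s \<le> (killed D ^^ n) h s"
  by (induction n arbitrary: s) (auto intro: killed_mono)

lemma iter_add:
  "(killed D ^^ n) (\<lambda>s. f s + h s) = (\<lambda>s. (killed D ^^ n) f s + (killed D ^^ n) h s)"
  by (induction n) (simp_all add: killed_add)

lemma iter_cmult: "(killed D ^^ n) (\<lambda>s. c * f s) = (\<lambda>s. c * (killed D ^^ n) f s)"
  by (induction n) (simp_all add: killed_cmult)

lemma iter_SUP:
  assumes "incseq f"
  shows "(killed D ^^ n) (\<lambda>s. SUP i. f i s) = (\<lambda>s. SUP i. (killed D ^^ n) (f i) s)"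
proof (induction n)
  case (Suc n)
  have "incseq (\<lambda>i. (killed D ^^ n) (f i))"
    using assms by (auto simp: mono_def le_fun_def intro!: iter_mono)
  then show ?case
    by (simp add: Suc killed_SUP)
qed simp

lemma survival_le_1: "survival D n s \<le> 1"
proof (induction n arbitrary: s)
  case (Suc n)
  have "killed D (survival D n) s \<le> killed D (\<lambda>_. 1) s"
    by (intro killed_mono Suc)
  then show ?case
    using killed_one_le[of D s] by simp
qed simp

lemma occupation_mono: "(\<And>s. f s \<le> h s) \<Longrightarrow> occupation D f s \<le> occupation D h s"
  unfolding occupation_def by (intro suminf_le iter_mono) auto

lemma occupation_add:
  "occupation D (\<lambda>s. f s + h s) s = occupation D f s + occupation D h s"
  unfolding occupation_def by (simp add: iter_add suminf_add)

lemma occupation_SUP: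
  assumes "incseq f"
  shows "occupation D (\<lambda>s. SUP i. f i s) s = (SUP i. occupation D (f i) s)"
proof -
  have "incseq (\<lambda>i. (killed D ^^ n) (f i) s)" for n
    using assms by (auto simp: mono_def le_fun_def intro!: iter_mono)
  then show ?thesis
    unfolding occupation_def by (simp add: iter_SUP[OF assms] ennreal_suminf_SUP_eq)
qed

lemma occupation_unfold: "occupation D f s = f s + killed D (occupation D f) s"
proof -
  have "occupation D f s = (\<Sum>n. (killed D ^^ Suc n) f s) + f s"
    unfolding occupation_def
    by (subst suminf_offset[where i = 1]) (simp_all add: summableI)
  also have "(\<Sum>n. (killed D ^^ Suc n) f s) = killed D (occupation D f) s"
    by (simp add: occupation_def[abs_def] killed_suminf)
  finally show ?thesis
    by (simp add: add.commute)
qed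

text \<open>Occupation sums are excessive: running the killed chain for \<open>n\<close> steps first
  only discards the contributions of the earlier times.\<close>

lemma iter_occupation_le: "(killed D ^^ n) (occupation D f) s \<le> occupation D f s"
proof (induction n arbitrary: s)
  case (Suc n)
  have "killed D ((killed D ^^ n) (occupation D f)) s \<le> killed D (occupation D f) s"
    by (intro killed_mono Suc)
  also have "\<dots> \<le> occupation D f s"
    using occupation_unfold[of D f s] by simp
  finally show ?case
    by simp
qed simp

text \<open>
  A visit to \<open>w\<close> at time \<open>n\<close> is followed by killing during the next \<open>k\<close> steps with probability
  \<open>1 - survival D k w\<close>, and killing happens during the \<open>k\<close> steps after time \<open>n\<close> for at most \<open>k\<close>
  values of \<open>n\<close>.
\<close>

lemma occupation_point_bounded:
  assumes "survival D k w < 1"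
  shows "\<exists>C<\<top>. \<forall>s. occupation D (indicator {w}) s \<le> C"
proof (intro exI conjI allI)
  let ?e = "1 - survival D k w"
  have e: "?e > 0"
    using assms by (simp add: diff_gt_0_iff_gt_ennreal)
  show "of_nat k / ?e < \<top>"
    using e by (subst less_top[symmetric]) (auto simp: ennreal_divide_eq_top_iff)
  fix s
  have step: "survival D (n + k) s + ?e * (killed D ^^ n) (indicator {w}) s \<le> survival D n s" for n
  proof -
    have "survival D (n + k) s + ?e * (killed D ^^ n) (indicator {w}) s
        = (killed D ^^ n) (\<lambda>t. survival D k t + ?e * indicator {w} t) s"
      by (simp add: iter_add iter_cmult funpow_add)
    also have "\<dots> \<le> (killed D ^^ n) (\<lambda>_. 1) s"
      by (intro iter_mono)
        (auto simp: indicator_def survival_le_1 add_diff_inverse_ennreal)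
    finally show ?thesis .
  qed
  \<comment> \<open>The survival terms at distance \<open>k\<close> telescope, leaving at most the
    first \<open>k\<close> of them, each at most 1. The remaining survival sum is finite, so it may
    be cancelled among extended reals.\<close>
  have sum: "?e * (\<Sum>n<N. (killed D ^^ n) (indicator {w}) s) \<le> of_nat k" for N
  proof -
    let ?S = "\<lambda>n. survival D n s"
    have "(\<Sum>n<N. ?S (n + k)) + ?e * (\<Sum>n<N. (killed D ^^ n) (indicator {w}) s) \<le> (\<Sum>n<N. ?S n)"
      using step by (simp add: sum_distrib_left sum.distrib[symmetric] sum_mono)
    also have "\<dots> \<le> (\<Sum>n<k + N. ?S n)"
      by (intro sum_mono2) auto
    also have "\<dots> = (\<Sum>n<k. ?S n) + (\<Sum>n<N. ?S (n + k))"
      by (induction N) (simp_all add: add.commute add.left_commute)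
    also have "(\<Sum>n<k. ?S n) \<le> (\<Sum>n<k. 1)"
      by (intro sum_mono survival_le_1)
    finally have "(\<Sum>n<N. ?S (n + k)) + ?e * (\<Sum>n<N. (killed D ^^ n) (indicator {w}) s)
        \<le> (\<Sum>n<N. ?S (n + k)) + of_nat k"
      by (simp add: add.commute)
    moreover have "?S n \<noteq> \<top>" for n
      using survival_le_1[of n D s] by (auto simp: top_unique)
    then have "(\<Sum>n<N. ?S (n + k)) \<noteq> \<infinity>"
      by simp
    ultimately show ?thesis
      by (simp add: ennreal_add_left_cancel_le)
  qed
  show "occupation D (indicator {w}) s \<le> of_nat k / ?e"
    unfolding occupation_def
  proof (intro suminf_le_const summableI)
    fix N
    have "(\<Sum>n<N. (killed D ^^ n) (indicator {w}) s)
        = ?e * (\<Sum>n<N. (killed D ^^ n) (indicator {w}) s) / ?e"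
      using e by (subst mult.commute, subst ennreal_mult_divide_eq) auto
    also have "\<dots> \<le> of_nat k / ?e"
      by (intro divide_right_mono_ennreal sum)
    finally show "(\<Sum>n<N. (killed D ^^ n) (indicator {w}) s) \<le> of_nat k / ?e" .
  qed
qed

text \<open>Used twice: for the single chain killed at a reference state, and for the pair chain
  killed on the diagonal. The bound is uniform in the starting point.\<close>

lemma occupation_finite_set_bounded:
  assumes "finite F" and "\<And>w. w \<in> F \<Longrightarrow> \<exists>k. survival D k w < 1"
  shows "\<exists>C<\<top>. \<forall>s. occupation D (indicator F) s \<le> C"
  using assms
proof (induction F)
  case empty
  have "(killed D ^^ n) (\<lambda>_. 0) s = 0" for n s
    by (induction n arbitrary: s) (simp_all add: killed_def)
  then show ?case
    by (intro exI[of _ 0]) (simp add: occupation_def indicator_def)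
next
  case (insert w F)
  obtain C where C: "C < \<top>" "\<And>s. occupation D (indicator F) s \<le> C"
    using insert by auto
  obtain C' where C': "C' < \<top>" "\<And>s. occupation D (indicator {w}) s \<le> C'"
    using insert.prems occupation_point_bounded by blast
  have "indicator (insert w F) = (\<lambda>s. indicator {w} s + indicator F s :: ennreal)"
    using insert.hyps by (auto simp: indicator_def)
  then show ?case
    using C C' by (intro exI[of _ "C' + C"]) (auto simp: occupation_add add_mono)
qed

section \<open>Mean return times and the Poisson equation\<close>

text \<open>If no killed iterate charged \<open>w\<close> from \<open>z\<close>, arrivals in
  \<open>z\<close> would contribute nothing to later visits to \<open>w\<close>. Killing at
  \<open>z\<close> would then make no difference, and the free chain from \<open>z\<close> would
  never visit \<open>w\<close> either.\<close>

lemma reached_before_return: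
  assumes "(killed {} ^^ n) (indicator {w}) z > 0"
  shows "\<exists>n. (killed {z} ^^ n) (indicator {w}) z > 0"
proof (rule ccontr)
  assume "\<not> ?thesis"
  then have never: "(killed {z} ^^ n) (indicator {w}) z = 0" for n
    by (simp add: zero_less_iff_neq_zero)
  have "(killed {} ^^ n) (indicator {w}) = (killed {z} ^^ n) (indicator {w})" for n
  proof (induction n)
    case (Suc n)
    have "killed {} ((killed {z} ^^ n) (indicator {w})) s = killed {z} ((killed {z} ^^ n) (indicator {w})) s" for s
      by (subst killed_empty_split[where z = z]) (simp add: never)
    then show ?case
      by (simp add: Suc fun_eq_iff)
  qed simp
  then show False
    using assms never by simp
qed

text \<open>From \<open>z\<close> the chain is at \<open>w\<close> with positive probability before
  returning, and the time still to wait from \<open>w\<close> is then part of the finite mean return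
  time of \<open>z\<close>.\<close>

lemma return_time_finite:
  assumes irr: "\<And>w. \<exists>n. (killed {} ^^ n) (indicator {w}) z > 0"
    and pos: "occupation {z} (\<lambda>_. 1) z < \<top>"
  shows "occupation {z} (\<lambda>_. 1) w < \<top>"
proof -
  let ?h = "occupation {z} (\<lambda>_. 1)"
  obtain n where n: "(killed {z} ^^ n) (indicator {w}) z > 0"
    using irr reached_before_return by blast
  have "?h w * (killed {z} ^^ n) (indicator {w}) z = (killed {z} ^^ n) (\<lambda>s. ?h w * indicator {w} s) z"
    by (simp add: iter_cmult)
  also have "\<dots> \<le> (killed {z} ^^ n) ?h z"
    by (intro iter_mono) (auto simp: indicator_def)
  also have "\<dots> \<le> ?h z"
    by (rule iter_occupation_le)
  also have "\<dots> < \<top>"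
    by (rule pos)
  finally show ?thesis
    using n by (auto simp: ennreal_mult_less_top)
qed

lemma survival_less_1:
  assumes "occupation D (\<lambda>_. 1) w < \<top>"
  shows "\<exists>k. survival D k w < 1"
proof (rule ccontr)
  assume "\<not> ?thesis"
  then have "survival D k w = 1" for k
    using survival_le_1[of k D w] by (meson le_less)
  then show False
    using assms nn_integral_count_space_nat[of "\<lambda>_. 1"] by (simp add: occupation_def)
qed

text \<open>
  The Poisson equation for \<open>1 - c * indicator F\<close>, where \<open>1 / c\<close> is the stationary mass of \<open>F\<close> by
  the cycle formula. The potential is the mean time to return to \<open>z\<close> minus \<open>c\<close> times the mean
  number of visits to \<open>F\<close> until then; the latter is bounded because \<open>F\<close> is finite, so a constant
  makes the potential nonnegative.
\<close>

lemma poisson_potential: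
  assumes irr: "\<And>w. \<exists>n. (killed {} ^^ n) (indicator {w}) z > 0"
    and pos: "occupation {z} (\<lambda>_. 1) z < \<top>"
  shows "\<exists>F c V. finite F \<and> c < 2 \<and> (\<forall>s. V s < \<top>) \<and>
    (\<forall>s. killed {} V s + 1 = V s + c * indicator F s)"
proof -
  let ?h = "occupation {z} (\<lambda>_. 1)"
  have h: "?h w < \<top>" for w
    by (rule return_time_finite[OF irr pos])
  define F where "F i = {s :: 's. to_nat s < i}" for i
  have finF: "finite (F i)" for i
    unfolding F_def
    using finite_vimage_IntI[of "{..<i}" to_nat "UNIV :: 's set"] by (simp add: vimage_def)
  have inc: "incseq (\<lambda>i. indicator (F i) :: 's \<Rightarrow> ennreal)"
    by (auto simp: mono_def le_fun_def F_def indicator_def)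
  have "(SUP i. indicator (F i) s :: ennreal) = 1" for s
    by (intro antisym SUP_least SUP_upper2[of "Suc (to_nat s)"]) (auto simp: F_def indicator_def)
  then have SUP: "?h z = (SUP i. occupation {z} (indicator (F i)) z)"
    using occupation_SUP[OF inc, of "{z}" z] by simp
  have "?h z \<noteq> 0"
    using occupation_unfold[of "{z}" "\<lambda>_. 1" z] by simp
  with h[of z] have "?h z / 2 < ?h z"
    by (rule half_less_ennreal[rotated])
  then have "?h z / 2 < (SUP i. occupation {z} (indicator (F i)) z)"
    unfolding SUP[symmetric] .
  then obtain i where i: "?h z / 2 < occupation {z} (indicator (F i)) z"
    unfolding less_SUP_iff by blast
  let ?F = "F i" and ?a = "occupation {z} (indicator (F i))"
  have a_le_h: "?a s \<le> ?h s" for s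
    by (intro occupation_mono) (auto simp: indicator_def)
  have a: "?a s < \<top>" for s
    using a_le_h h le_less_trans by blast
  obtain B where B: "B < \<top>" "\<And>s. ?a s \<le> B"
    using occupation_finite_set_bounded[OF finF survival_less_1[OF h]] by blast
  define c where "c = ?h z / ?a z"
  have a0: "?a z > 0"
    using i by (rule le_less_trans[rotated]) simp
  have ca: "c * ?a z = ?h z"
    using a0 a[of z] by (simp add: c_def ennreal_divide_times mult_divide_eq_ennreal)
  have c2: "c < 2"
  proof (rule ccontr)
    assume "\<not> c < 2"
    then have "2 * ?a z \<le> ?h z"
      using ca by (metis mult_right_mono not_less zero_le)
    then have "2 * ?a z / 2 \<le> ?h z / 2"
      by (rule divide_right_mono_ennreal)
    then show False
      using i by (simp add: mult.commute[of 2] mult_divide_eq_ennreal)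
  qed
  then have c: "c < \<top>"
    using less_trans by fastforce
  \<comment> \<open>This is \<open>?h - c * ?a\<close> plus the constant \<open>c * B\<close>. The
    constant is put inside the difference because subtraction is truncated;
    \<open>?a s \<le> B\<close> makes it exact.\<close>
  define V where "V s = ?h s + c * (B - ?a s)" for s
  have cB: "c * (B - ?a s) + c * ?a s = c * B" for s
    using B(2) by (simp add: distrib_left[symmetric] diff_add_cancel_ennreal)
  \<comment> \<open>First-step analysis with the free operator instead of the killed one: the mass
    arriving in \<open>z\<close> starts a new cycle and contributes an extra term.\<close>
  have unfold: "killed {} (occupation {z} f) s + f s
      = occupation {z} f s + killed {} (indicator {z}) s * occupation {z} f z" for f s
  proof -
    have "killed {} (occupation {z} f) s + f s = (f s + killed {z} (occupation {z} f) s)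
        + killed {} (indicator {z}) s * occupation {z} f z"
      by (subst killed_empty_split[where z = z]) (simp only: ac_simps)
    then show ?thesis
      by (simp only: occupation_unfold[of "{z}" f s, symmetric])
  qed
  have V: "killed {} V s + 1 = V s + c * indicator ?F s" for s
  proof -
    let ?p = "killed {} (indicator {z}) s"
    \<comment> \<open>Adding \<open>?r\<close> to both sides clears the terms subtracted in
      \<open>killed {} V s\<close> and in \<open>V s\<close>. It is finite, hence cancels at the
      end.\<close>
    let ?r = "c * killed {} ?a s + c * ?a s"
    have "killed {} V s + c * killed {} ?a s = killed {} (\<lambda>s. V s + c * ?a s) s"
      by (simp only: killed_add killed_cmult)
    also have "(\<lambda>s. V s + c * ?a s) = (\<lambda>s. ?h s + c * B)"
      by (simp add: V_def add.assoc cB)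
    also have "killed {} (\<lambda>s. ?h s + c * B) s = killed {} ?h s + c * B"
      by (simp add: killed_add killed_empty_const)
    finally have "?r + (killed {} V s + 1) = (killed {} ?h s + 1) + c * B + c * ?a s"
      by (simp add: ac_simps)
    \<comment> \<open>Here the choice of \<open>c\<close> matters: \<open>?h z = c * ?a z\<close>
      makes the new-cycle terms of \<open>?h\<close> and of \<open>c * ?a\<close> equal.\<close>
    also have "killed {} ?h s + 1 = ?h s + ?p * (c * ?a z)"
      using unfold[of "\<lambda>_. 1" s] by (simp only: ca)
    also have "\<dots> + c * B + c * ?a s = ?h s + c * B + c * (?a s + ?p * ?a z)"
      by (simp add: algebra_simps)
    also have "?a s + ?p * ?a z = killed {} ?a s + indicator ?F s"
      by (simp only: unfold)
    also have "?h s + c * B + c * (killed {} ?a s + indicator ?F s) = ?r + (V s + c * indicator ?F s)"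
      unfolding cB[of s, symmetric] by (simp add: V_def algebra_simps)
    finally have "?r + (killed {} V s + 1) = ?r + (V s + c * indicator ?F s)" .
    moreover have "killed {} ?a s \<le> killed {} (\<lambda>_. B) s"
      by (intro killed_mono B)
    then have "?r < \<top>"
      using B c a by (auto simp: killed_empty_const ennreal_mult_less_top intro: le_less_trans)
    ultimately show ?thesis
      by (auto simp: ennreal_add_left_cancel)
  qed
  have "V s < \<top>" for s
    using h B c by (auto simp: V_def ennreal_mult_less_top intro: le_less_trans[OF diff_le_self_ennreal])
  then show ?thesis
    using finF[of i] c2 V by blast
qed

end

section \<open>The two-point motion\<close>

lemma measurable_map_prod_count_space:
  fixes f :: "'w \<Rightarrow> 'a \<Rightarrow> 'b::countable" and g :: "'w \<Rightarrow> 'c \<Rightarrow> 'd::countable"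
  assumes [measurable]: "\<And>x. (\<lambda>\<omega>. f \<omega> x) \<in> N \<rightarrow>\<^sub>M count_space UNIV"
    "\<And>x. (\<lambda>\<omega>. g \<omega> x) \<in> N \<rightarrow>\<^sub>M count_space UNIV"
  shows "(\<lambda>\<omega>. map_prod (f \<omega>) (g \<omega>) p) \<in> N \<rightarrow>\<^sub>M count_space UNIV"
proof -
  have "(\<lambda>\<omega>. (f \<omega> (fst p), g \<omega> (snd p))) \<in> N \<rightarrow>\<^sub>M count_space UNIV \<Otimes>\<^sub>M count_space UNIV"
    by measurable
  then show ?thesis
    by (simp add: pair_measure_countable map_prod_def case_prod_beta)
qed

lemma (in random_map) random_map_pair: "random_map M (\<lambda>\<omega>. map_prod (g \<omega>) (g \<omega>))"
  by unfold_locales (intro measurable_map_prod_count_space measurable_map)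

lemma (in random_map) pair_occupation_finite:
  assumes irr: "\<And>w. \<exists>n. (killed {} ^^ n) (indicator {w}) z > 0"
    and pos: "occupation {z} (\<lambda>_. 1) z < \<top>"
    and sync: "\<And>u v. \<exists>k.
      (random_map.killed M (\<lambda>\<omega>. map_prod (g \<omega>) (g \<omega>)) Id ^^ k) (\<lambda>_. 1) (u, v) < 1"
  shows "random_map.occupation M (\<lambda>\<omega>. map_prod (g \<omega>) (g \<omega>)) Id (\<lambda>_. 1) p < \<top>"
proof -
  interpret pair: random_map M "\<lambda>\<omega>. map_prod (g \<omega>) (g \<omega>)"
    by (rule random_map_pair)
  obtain F c V where F: "finite F" and c: "c < 2" and V: "\<And>s. V s < \<top>"
    and poisson: "\<And>s. killed {} V s + 1 = V s + c * indicator F s"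
    using poisson_potential[OF irr pos] by blast
  define W where "W q = V (fst q) + V (snd q)" for q
  let ?K = "pair.killed Id" and ?I = "indicator (F \<times> F) :: _ \<Rightarrow> ennreal" and ?e = "2 - c"
  have c_fin: "c < \<top>"
    using c less_trans by fastforce
  have ce: "c + ?e = 2"
    using c by (simp add: add_diff_inverse_ennreal)
  have drift: "?K W q + ?e \<le> W q + c * ?I q" for q
  proof -
    obtain u v where q: "q = (u, v)"
      by (cases q)
    \<comment> \<open>Killing on the diagonal can only lower the expected value of the nonnegative
      \<open>W\<close>.\<close>
    have "?K W q \<le> (\<integral>\<^sup>+\<omega>. V (g \<omega> u) + V (g \<omega> v) \<partial>M)"
      unfolding pair.killed_def q by (intro nn_integral_mono) (auto simp: W_def indicator_def)
    also have "\<dots> = killed {} V u + killed {} V v"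
      by (simp add: killed_def nn_integral_add)
    finally have "?K W q + 2 \<le> (killed {} V u + 1) + (killed {} V v + 1)"
      by (simp add: add_mono ac_simps flip: one_add_one)
    also have "\<dots> = W q + (c * indicator F u + c * indicator F v)"
      unfolding poisson by (simp add: W_def q ac_simps)
    \<comment> \<open>The sum of the indicators of \<open>u\<close> and \<open>v\<close> in
      \<open>F\<close> is at most 1 plus the indicator of both being in \<open>F\<close>. The
      surplus \<open>c\<close> is absorbed by the 2 gained from the two Poisson equations, leaving
      \<open>?e = 2 - c\<close>.\<close>
    also have "\<dots> \<le> W q + (c + c * ?I q)"
      by (intro add_left_mono) (auto simp: q indicator_def)
    finally have "?K W q + (c + ?e) \<le> W q + (c + c * ?I q)"
      by (simp only: ce)
    then have "c + (?K W q + ?e) \<le> c + (W q + c * ?I q)"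
      by (simp only: ac_simps)
    then show ?thesis
      using c_fin by (auto simp: ennreal_add_left_cancel_le)
  qed
  \<comment> \<open>The drift inequality is iterated along the killed pair chain. The term with
    \<open>W\<close> at time \<open>N\<close> is kept for the induction and dropped
    afterwards.\<close>
  have sum: "?e * (\<Sum>n<N. (?K ^^ n) (\<lambda>_. 1) p) + (?K ^^ N) W p
      \<le> W p + c * (\<Sum>n<N. (?K ^^ n) ?I p)" for N
  proof (induction N)
    case (Suc N)
    have "(?K ^^ Suc N) W p + ?e * (?K ^^ N) (\<lambda>_. 1) p = (?K ^^ N) (\<lambda>q. ?K W q + ?e * 1) p"
      by (simp only: pair.iter_add pair.iter_cmult) (simp add: funpow_swap1)
    also have "\<dots> \<le> (?K ^^ N) (\<lambda>q. W q + c * ?I q) p"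
      using drift by (intro pair.iter_mono) simp
    also have "\<dots> = (?K ^^ N) W p + c * (?K ^^ N) ?I p"
      by (simp add: pair.iter_add pair.iter_cmult)
    finally have "?e * (\<Sum>n<N. (?K ^^ n) (\<lambda>_. 1) p) + ((?K ^^ Suc N) W p + ?e * (?K ^^ N) (\<lambda>_. 1) p)
        \<le> ?e * (\<Sum>n<N. (?K ^^ n) (\<lambda>_. 1) p) + ((?K ^^ N) W p + c * (?K ^^ N) ?I p)"
      by (rule add_left_mono)
    also have "\<dots> \<le> W p + c * (\<Sum>n<N. (?K ^^ n) ?I p) + c * (?K ^^ N) ?I p"
      using add_right_mono[OF Suc] by (simp only: add.assoc)
    finally show ?case
      by (simp add: distrib_left ac_simps)
  qed simp
  obtain C where C: "C < \<top>" "\<And>q. pair.occupation Id ?I q \<le> C"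
    using pair.occupation_finite_set_bounded[of "F \<times> F" Id] F sync by auto
  have "?e * pair.occupation Id (\<lambda>_. 1) p \<le> W p + c * C"
    unfolding pair.occupation_def ennreal_suminf_cmult[symmetric]
  proof (intro suminf_le_const summableI)
    fix N
    have "(\<Sum>n<N. ?e * (?K ^^ n) (\<lambda>_. 1) p) \<le> W p + c * (\<Sum>n<N. (?K ^^ n) ?I p)"
      using order_trans[OF _ sum[of N]] by (simp add: sum_distrib_left)
    also have "\<dots> \<le> W p + c * pair.occupation Id ?I p"
      unfolding pair.occupation_def
      by (intro add_left_mono mult_left_mono sum_le_suminf summableI) auto
    also have "\<dots> \<le> W p + c * C"
      by (intro add_left_mono mult_left_mono C) simp
    finally show "(\<Sum>n<N. ?e * (?K ^^ n) (\<lambda>_. 1) p) \<le> W p + c * C" .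
  qed
  also have "\<dots> < \<top>"
    using V c_fin C by (simp add: W_def ennreal_mult_less_top)
  finally have "?e * pair.occupation Id (\<lambda>_. 1) p < \<top>" .
  \<comment> \<open>The strict bound \<open>c < 2\<close>, that is, mass of \<open>F\<close> above
    one half, lets the factor be removed.\<close>
  moreover have "?e \<noteq> 0"
    using c by (simp add: diff_eq_0_iff_ennreal not_le)
  ultimately show ?thesis
    by (auto simp: ennreal_mult_less_top)
qed

section \<open>Past, future and the Markov property\<close>

context random_dynamical_system
begin

text \<open>Packaged as measures only to speak of random variables measurable with respect to these
  sigma-algebras.\<close>

abbreviation past :: "'w measure" where
  "past \<equiv> sigma (space M) (\<Union>s\<in>{..<0}. F_between s 0)"

abbreviation future :: "'w measure" where
  "future \<equiv> sigma (space M) (\<Union>t\<in>{0<..}. F_between 0 t)"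

lemma F_between_subset: "F_between s t \<subseteq> Pow (space M)"
proof
  fix A assume "A \<in> F_between s t"
  then show "A \<in> Pow (space M)"
    unfolding F_between_def
    by (intro PowI, elim sigma_sets_into_sp[rotated])
      (use sets.sets_into_space in \<open>auto simp: null_sets_def\<close>)
qed

lemma sets_past: "sets past = F_until 0" and sets_future: "sets future = F_from 0"
  unfolding F_until_def F_from_def using F_between_subset by (simp_all add: UN_least)

lemma theta_measurable[measurable]: "\<theta> n \<in> M \<rightarrow>\<^sub>M M"
  using theta_preserving[of n] by (simp add: measure_preserving_map_def)

lemma emeasure_theta:
  assumes "A \<in> sets M"
  shows "emeasure M {\<omega> \<in> space M. \<theta> n \<omega> \<in> A} = emeasure M A"
proof -
  have "emeasure M A = emeasure (distr M M (\<theta> n)) A"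
    using theta_preserving[of n] by (simp add: measure_preserving_map_def)
  also have "\<dots> = emeasure M (\<theta> n -` A \<inter> space M)"
    using assms by (intro emeasure_distr) auto
  also have "\<theta> n -` A \<inter> space M = {\<omega> \<in> space M. \<theta> n \<omega> \<in> A}"
    by auto
  finally show ?thesis ..
qed

lemma theta_inverse: "\<omega> \<in> space M \<Longrightarrow> \<theta> (- 1) (\<theta> 1 \<omega>) = \<omega>"
  using theta_add[of \<omega> "- 1" 1] theta_zero[of \<omega>] by simp

lemma phi_past: "(\<lambda>\<omega>. \<phi> 1 (\<theta> (- 1) \<omega>) x) \<in> past \<rightarrow>\<^sub>M count_space UNIV"
proof (rule measurableI)
  fix B :: "'x set"
  have "(\<lambda>\<omega>. \<phi> 1 (\<theta> (- 1) \<omega>) x) -` B \<inter> space M \<in> F_between (- 1) 0"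
    unfolding F_between_def
    by (intro sigma_sets.Basic UnI2 CollectI exI[of _ "- 1"] exI[of _ 1] exI[of _ x] exI[of _ B]) auto
  then show "(\<lambda>\<omega>. \<phi> 1 (\<theta> (- 1) \<omega>) x) -` B \<inter> space past \<in> sets past"
    unfolding sets_past F_until_def space_measure_of_conv
    by (intro sigma_sets.Basic UN_I[of "- 1"]) auto
qed simp

lemma phi_future: "(\<lambda>\<omega>. \<phi> n \<omega> x) \<in> future \<rightarrow>\<^sub>M count_space UNIV"
proof (rule measurableI)
  fix B :: "'x set"
  \<comment> \<open>The end point is \<open>int n + 1\<close> rather than \<open>int n\<close>
    because \<open>F_from 0\<close> admits only positive end points, also for
    \<open>n = 0\<close>.\<close>
  have "(\<lambda>\<omega>. \<phi> n (\<theta> 0 \<omega>) x) -` B \<inter> space M \<in> F_between 0 (int n + 1)"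
    unfolding F_between_def
    by (intro sigma_sets.Basic UnI2 CollectI exI[of _ 0] exI[of _ n] exI[of _ x] exI[of _ B]) auto
  moreover have "(\<lambda>\<omega>. \<phi> n (\<theta> 0 \<omega>) x) -` B \<inter> space M = (\<lambda>\<omega>. \<phi> n \<omega> x) -` B \<inter> space M"
    by (auto simp: theta_zero)
  ultimately show "(\<lambda>\<omega>. \<phi> n \<omega> x) -` B \<inter> space future \<in> sets future"
    unfolding sets_future F_from_def space_measure_of_conv
    by (intro sigma_sets.Basic UN_I[of "int n + 1"]) auto
qed simp

text \<open>
  Shifting by \<open>\<theta> 1\<close> moves the first step into the past of time \<open>0\<close>, which is independent of the
  future.
\<close>

lemma emeasure_first_step:
  fixes Z :: "'w \<Rightarrow> 's::countable"
  assumes markov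
    and past: "(\<lambda>\<omega>. Z (\<theta> (- 1) \<omega>)) \<in> past \<rightarrow>\<^sub>M count_space UNIV"
    and E: "E \<in> F_from 0"
  shows "emeasure M {\<omega> \<in> space M. Z \<omega> = t \<and> \<theta> 1 \<omega> \<in> E}
    = emeasure M {\<omega> \<in> space M. Z \<omega> = t} * emeasure M E"
proof -
  have indep: "indep_set (F_until 0) (F_from 0)"
    using \<open>markov\<close> by (simp add: markov_def)
  let ?A = "{\<omega> \<in> space M. Z (\<theta> (- 1) \<omega>) = t}"
  have A: "?A \<in> F_until 0"
    using measurable_sets[OF past, of "{t}"]
    by (simp add: sets_past space_measure_of_conv vimage_def Int_def conj_commute)
  have ev: "?A \<in> sets M" "E \<in> sets M"
    using indep_setD_ev1[OF indep] indep_setD_ev2[OF indep] A E by auto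
  have th: "\<theta> 1 \<omega> \<in> space M" if "\<omega> \<in> space M" for \<omega>
    using measurable_space[OF theta_measurable that] .
  have "emeasure M {\<omega> \<in> space M. Z \<omega> = t \<and> \<theta> 1 \<omega> \<in> E} = emeasure M {\<omega> \<in> space M. \<theta> 1 \<omega> \<in> ?A \<inter> E}"
    by (intro arg_cong[where f = "emeasure M"]) (auto simp: theta_inverse th)
  also have "\<dots> = emeasure M (?A \<inter> E)"
    using ev by (intro emeasure_theta) auto
  also have "\<dots> = emeasure M ?A * emeasure M E"
    using indep_setD[OF indep A E] by (simp add: emeasure_eq_measure ennreal_mult)
  also have "emeasure M ?A = emeasure M {\<omega> \<in> space M. \<theta> 1 \<omega> \<in> ?A}"
    by (rule emeasure_theta[OF ev(1), symmetric])
  also have "{\<omega> \<in> space M. \<theta> 1 \<omega> \<in> ?A} = {\<omega> \<in> space M. Z \<omega> = t}"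
    by (auto simp: theta_inverse th)
  finally show ?thesis .
qed

text \<open>Stated for an abstract cocycle \<open>Z\<close> to cover the one-point and the two-point
  motion at once. Induction on \<open>n\<close> splits off the first step, which is independent of
  the shifted future. \<open>D\<close> is not tested at time 0, in accordance with
  \<open>killed\<close>.\<close>

lemma emeasure_killed_iter:
  fixes Z :: "nat \<Rightarrow> 'w \<Rightarrow> 's::countable \<Rightarrow> 's"
  assumes markov
    and zero: "\<And>\<omega> s. \<omega> \<in> space M \<Longrightarrow> Z 0 \<omega> s = s"
    and step: "\<And>\<omega> n s. \<omega> \<in> space M \<Longrightarrow> Z (Suc n) \<omega> s = Z n (\<theta> 1 \<omega>) (Z 1 \<omega> s)"
    and past: "\<And>s. (\<lambda>\<omega>. Z 1 (\<theta> (- 1) \<omega>) s) \<in> past \<rightarrow>\<^sub>M count_space UNIV"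
    and future: "\<And>n s. (\<lambda>\<omega>. Z n \<omega> s) \<in> future \<rightarrow>\<^sub>M count_space UNIV"
  shows "emeasure M {\<omega> \<in> space M. Z n \<omega> s \<in> B \<and> (\<forall>j\<in>{1..n}. Z j \<omega> s \<notin> D)}
      = (random_map.killed M (Z 1) D ^^ n) (indicator B) s"
proof -
  have "F_from 0 \<subseteq> sets M"
    using \<open>markov\<close> indep_setD_ev2 by (auto simp: markov_def)
  then have Z[measurable]: "(\<lambda>\<omega>. Z n \<omega> s) \<in> M \<rightarrow>\<^sub>M count_space UNIV" for n s
    using measurable_sets[OF future[of n s]]
    by (intro measurableI) (auto simp: sets_future space_measure_of_conv)
  interpret random_map M "Z 1"
    by unfold_locales simp
  define E where "E n s = {\<omega> \<in> space M. Z n \<omega> s \<in> B \<and> (\<forall>j\<in>{1..n}. Z j \<omega> s \<notin> D)}" for n s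
  have E: "E n s \<in> F_from 0" for n s
  proof -
    note future[measurable]
    have "{\<omega> \<in> space future. Z n \<omega> s \<in> B \<and> (\<forall>j\<in>{1..n}. Z j \<omega> s \<notin> D)} \<in> sets future"
      by measurable
    then show ?thesis
      by (simp add: E_def sets_future space_measure_of_conv)
  qed
  have E_sets[measurable]: "E n s \<in> sets M" for n s
    using E \<open>F_from 0 \<subseteq> sets M\<close> by auto
  have "emeasure M (E n s) = (killed D ^^ n) (indicator B) s"
  proof (induction n arbitrary: s)
    case 0
    have "E 0 s = (if s \<in> B then space M else {})"
      by (auto simp: E_def zero)
    then show ?case
      by (simp add: emeasure_space_1)
  next
    case (Suc n)
    \<comment> \<open>By the cocycle property, the event is a condition on the first step together
      with the event for \<open>n\<close> steps, shifted by \<open>\<theta> 1\<close> and started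
      from the state reached.\<close>
    have "\<omega> \<in> E (Suc n) s \<longleftrightarrow> Z 1 \<omega> s \<notin> D \<and> \<theta> 1 \<omega> \<in> E n (Z 1 \<omega> s)" if "\<omega> \<in> space M" for \<omega>
    proof -
      have S: "{1..Suc n} = insert 1 (Suc ` {1..n})"
        by (auto simp: image_Suc_atLeastAtMost)
      have "(\<forall>j\<in>{1..Suc n}. Z j \<omega> s \<notin> D) \<longleftrightarrow> Z 1 \<omega> s \<notin> D \<and> (\<forall>j\<in>{1..n}. Z (Suc j) \<omega> s \<notin> D)"
        unfolding S by blast
      then show ?thesis
        using that measurable_space[OF theta_measurable that, of 1]
        by (simp only: E_def mem_Collect_eq step[OF that]) blast
    qed
    then have "emeasure M (E (Suc n) s)
        = (\<integral>\<^sup>+\<omega>. indicator (- D) (Z 1 \<omega> s) * indicator (E n (Z 1 \<omega> s)) (\<theta> 1 \<omega>) \<partial>M)"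
      by (subst nn_integral_indicator[symmetric, OF E_sets], intro nn_integral_cong)
        (simp add: indicator_def)
    also have "\<dots> = (\<integral>\<^sup>+t. (\<integral>\<^sup>+\<omega>. indicator (- D) t * indicator (E n t) (\<theta> 1 \<omega>) * indicator {t} (Z 1 \<omega> s) \<partial>M)
        \<partial>count_space UNIV)"
      by (rule nn_integral_split_value) measurable
    also have "\<dots> = (\<integral>\<^sup>+t. (\<integral>\<^sup>+\<omega>. emeasure M (E n t) * indicator (- D) t * indicator {t} (Z 1 \<omega> s) \<partial>M)
        \<partial>count_space UNIV)"
    proof (rule nn_integral_cong)
      fix t
      have "(\<integral>\<^sup>+\<omega>. indicator (E n t) (\<theta> 1 \<omega>) * indicator {t} (Z 1 \<omega> s) \<partial>M)
          = (\<integral>\<^sup>+\<omega>. indicator {\<omega> \<in> space M. Z 1 \<omega> s = t \<and> \<theta> 1 \<omega> \<in> E n t} \<omega> \<partial>M)"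
        by (intro nn_integral_cong) (auto simp: indicator_def)
      also have "\<dots> = emeasure M {\<omega> \<in> space M. Z 1 \<omega> s = t} * emeasure M (E n t)"
        unfolding emeasure_first_step[where Z = "\<lambda>\<omega>. Z 1 \<omega> s", OF \<open>markov\<close> past E, symmetric]
        by (rule nn_integral_indicator) measurable
      also have "emeasure M {\<omega> \<in> space M. Z 1 \<omega> s = t}
          = (\<integral>\<^sup>+\<omega>. indicator {\<omega> \<in> space M. Z 1 \<omega> s = t} \<omega> \<partial>M)"
        by (rule nn_integral_indicator[symmetric]) measurable
      also have "\<dots> = (\<integral>\<^sup>+\<omega>. indicator {t} (Z 1 \<omega> s) \<partial>M)"
        by (intro nn_integral_cong) (auto simp: indicator_def)
      finally show "(\<integral>\<^sup>+\<omega>. indicator (- D) t * indicator (E n t) (\<theta> 1 \<omega>) * indicator {t} (Z 1 \<omega> s) \<partial>M)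
          = (\<integral>\<^sup>+\<omega>. emeasure M (E n t) * indicator (- D) t * indicator {t} (Z 1 \<omega> s) \<partial>M)"
        by (simp add: nn_integral_cmult mult.assoc) (simp add: ac_simps)
    qed
    also have "\<dots> = (\<integral>\<^sup>+\<omega>. emeasure M (E n (Z 1 \<omega> s)) * indicator (- D) (Z 1 \<omega> s) \<partial>M)"
      by (rule nn_integral_split_value[symmetric]) measurable
    finally show ?case
      by (simp only: killed_def Suc funpow.simps(2) o_apply)
  qed
  then show "emeasure M {\<omega> \<in> space M. Z n \<omega> s \<in> B \<and> (\<forall>j\<in>{1..n}. Z j \<omega> s \<notin> D)}
      = (killed D ^^ n) (indicator B) s"
    by (simp add: E_def)
qed

section \<open>Return and synchronization times as occupation sums\<close>

lemma phi_Suc: "\<omega> \<in> space M \<Longrightarrow> \<phi> (Suc n) \<omega> x = \<phi> n (\<theta> 1 \<omega>) (\<phi> 1 \<omega> x)"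
  using phi_cocycle[of \<omega> n 1 x] by simp

lemma phi_measurable_fixed[measurable]: "(\<lambda>\<omega>. \<phi> n \<omega> x) \<in> M \<rightarrow>\<^sub>M count_space UNIV"
  using measurable_compose[OF _ phi_measurable, of "\<lambda>\<omega>. (\<omega>, n, x)" M] by simp

lemma random_map_phi: "random_map M (\<phi> 1)"
  by unfold_locales simp

lemma emeasure_chain_killed:
  assumes markov
  shows "emeasure M {\<omega> \<in> space M. \<phi> n \<omega> x \<in> B \<and> (\<forall>j\<in>{1..n}. \<phi> j \<omega> x \<notin> D)}
    = (random_map.killed M (\<phi> 1) D ^^ n) (indicator B) x"
  using emeasure_killed_iter[where Z = \<phi>, OF assms phi_zero phi_Suc phi_past phi_future] .

lemma emeasure_pair_survival:
  assumes markov
  shows "emeasure M {\<omega> \<in> space M. \<forall>j\<in>{1..n}. \<phi> j \<omega> x \<noteq> \<phi> j \<omega> y}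
    = (random_map.killed M (\<lambda>\<omega>. map_prod (\<phi> 1 \<omega>) (\<phi> 1 \<omega>)) Id ^^ n) (\<lambda>_. 1) (x, y)"
proof -
  let ?Z = "\<lambda>n \<omega>. map_prod (\<phi> n \<omega>) (\<phi> n \<omega>)"
  have "emeasure M {\<omega> \<in> space M. ?Z n \<omega> (x, y) \<in> UNIV \<and> (\<forall>j\<in>{1..n}. ?Z j \<omega> (x, y) \<notin> Id)}
    = (random_map.killed M (?Z 1) Id ^^ n) (indicator UNIV) (x, y)"
  proof (rule emeasure_killed_iter[where Z = ?Z, OF assms])
    fix \<omega> n and s :: "'x \<times> 'x"
    assume \<omega>: "\<omega> \<in> space M"
    show "?Z 0 \<omega> s = s"
      by (cases s) (simp add: phi_zero \<omega>)
    show "?Z (Suc n) \<omega> s = ?Z n (\<theta> 1 \<omega>) (?Z 1 \<omega> s)"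
      by (cases s) (simp only: map_prod_simp phi_Suc[OF \<omega>])
  qed (intro measurable_map_prod_count_space phi_past phi_future)+
  then show ?thesis
    by (simp add: indicator_def)
qed

text \<open>Tail-sum formula: the return time exceeds \<open>n\<close> exactly when \<open>z\<close>
  is avoided at times 1 to \<open>n\<close>, so its tails are survival probabilities.\<close>

lemma return_time_integral:
  assumes markov
  shows "(\<integral>\<^sup>+\<omega>. ennreal_of_enat (return_time z \<omega>) \<partial>M)
    = random_map.occupation M (\<phi> 1) {z} (\<lambda>_. 1) z"
proof -
  interpret random_map M "\<phi> 1"
    by (rule random_map_phi)
  have iff: "enat n < return_time z \<omega> \<longleftrightarrow> (\<forall>j\<in>{1..n}. \<phi> j \<omega> z \<notin> {z})" for n \<omega>
    unfolding return_time_def Inf_enat_greater_iff chain_def by auto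
  have "return_time z \<in> M \<rightarrow>\<^sub>M count_space UNIV"
    unfolding return_time_def[abs_def] chain_def by (rule measurable_Inf_enat) measurable
  then have "(\<integral>\<^sup>+\<omega>. ennreal_of_enat (return_time z \<omega>) \<partial>M)
      = (\<Sum>n. emeasure M {\<omega> \<in> space M. enat n < return_time z \<omega>})"
    by (rule nn_integral_enat_function)
  moreover have "emeasure M {\<omega> \<in> space M. enat n < return_time z \<omega>} = survival {z} n z" for n
    using emeasure_chain_killed[OF assms, of n z UNIV "{z}"] by (simp add: iff indicator_def)
  ultimately show ?thesis
    by (simp only: occupation_def)
qed

text \<open>Tail-sum formula again. Synchronization is tested from time 0 but killing only from time
  1; the two agree because \<open>x \<noteq> y\<close>.\<close>

lemma synchronization_time_integral:
  assumes markov "x \<noteq> y"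
  shows "(\<integral>\<^sup>+\<omega>. ennreal_of_enat (synchronization_time \<omega> x y) \<partial>M)
    = random_map.occupation M (\<lambda>\<omega>. map_prod (\<phi> 1 \<omega>) (\<phi> 1 \<omega>)) Id (\<lambda>_. 1) (x, y)"
proof -
  interpret pair: random_map M "\<lambda>\<omega>. map_prod (\<phi> 1 \<omega>) (\<phi> 1 \<omega>)"
    by (rule random_map.random_map_pair[OF random_map_phi])
  have iff: "enat n < synchronization_time \<omega> x y \<longleftrightarrow> (\<forall>j\<in>{1..n}. \<phi> j \<omega> x \<noteq> \<phi> j \<omega> y)"
    if "\<omega> \<in> space M" for n \<omega>
  proof -
    have "{..n} = insert 0 {1..n}"
      by auto
    then have "(\<forall>j\<le>n. \<phi> j \<omega> x \<noteq> \<phi> j \<omega> y) \<longleftrightarrow> (\<forall>j\<in>insert 0 {1..n}. \<phi> j \<omega> x \<noteq> \<phi> j \<omega> y)"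
      by (metis atMost_iff)
    then show ?thesis
      unfolding synchronization_time_def Inf_enat_greater_iff
      using that assms(2) by (simp add: phi_zero)
  qed
  have "(\<lambda>\<omega>. synchronization_time \<omega> x y) \<in> M \<rightarrow>\<^sub>M count_space UNIV"
    unfolding synchronization_time_def by (rule measurable_Inf_enat) measurable
  then have "(\<integral>\<^sup>+\<omega>. ennreal_of_enat (synchronization_time \<omega> x y) \<partial>M)
      = (\<Sum>n. emeasure M {\<omega> \<in> space M. enat n < synchronization_time \<omega> x y})"
    by (rule nn_integral_enat_function)
  moreover have "emeasure M {\<omega> \<in> space M. enat n < synchronization_time \<omega> x y}
      = pair.survival Id n (x, y)" for n
    using emeasure_pair_survival[OF assms(1), of n x y] by (simp add: iff cong: conj_cong)
  ultimately show ?thesis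
    by (simp only: pair.occupation_def)
qed

text \<open>Survival probability 1 for every \<open>k\<close> would exclude synchronization at all
  positive times almost surely. Diagonal pairs are included since \<open>F \<times> F\<close>
  contains them: they remain on the diagonal and are killed in the first step.\<close>

lemma pair_survival_less_1:
  assumes markov synchronizing
  shows "\<exists>k. (random_map.killed M (\<lambda>\<omega>. map_prod (\<phi> 1 \<omega>) (\<phi> 1 \<omega>)) Id ^^ k) (\<lambda>_. 1) (u, v) < 1"
proof (cases "u = v")
  case True
  have "{\<omega> \<in> space M. \<forall>j\<in>{1..1::nat}. \<phi> j \<omega> u \<noteq> \<phi> j \<omega> u} = {}"
    by auto
  then show ?thesis
    using emeasure_pair_survival[OF assms(1), of 1 u v] True by (intro exI[of _ 1]) simp
next
  case False
  show ?thesis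
  proof (rule ccontr)
    assume "\<not> ?thesis"
    then have *: "1 \<le> emeasure M {\<omega> \<in> space M. \<forall>j\<in>{1..k}. \<phi> j \<omega> u \<noteq> \<phi> j \<omega> v}" for k
      unfolding emeasure_pair_survival[OF assms(1)] not_ex not_less by blast
    have "AE \<omega> in M. \<forall>j\<in>{1..k}. \<phi> j \<omega> u \<noteq> \<phi> j \<omega> v" for k
      using *[of k] by (subst prob_Collect_eq_1[symmetric]) (auto simp: emeasure_eq_measure intro: antisym)
    then have "AE \<omega> in M. \<forall>k. \<forall>j\<in>{1..k}. \<phi> j \<omega> u \<noteq> \<phi> j \<omega> v"
      by (simp add: AE_all_countable)
    moreover have "AE \<omega> in M. \<exists>n. \<phi> n \<omega> u = \<phi> n \<omega> v"
      using assms(2) by (simp add: synchronizing_def)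
    ultimately have "AE \<omega> in M. False"
      using AE_space
    proof eventually_elim
      case (elim \<omega>)
      then obtain n where "\<phi> n \<omega> u = \<phi> n \<omega> v"
        by blast
      moreover from this have "n \<noteq> 0"
        using False elim by (auto simp: phi_zero intro: ccontr)
      then have "n \<in> {1..n}"
        by simp
      ultimately show ?case
        using elim by blast
    qed
    then show False
      by simp
  qed
qed

end

theorem theorem4p2:
  fixes M :: "'w measure"
    and \<theta> :: "int \<Rightarrow> 'w \<Rightarrow> 'w"
    and \<phi> :: "nat \<Rightarrow> 'w \<Rightarrow> 'x::countable \<Rightarrow> 'x"
    and x y :: 'x
  assumes "random_dynamical_system M \<theta> \<phi>"
    and "random_dynamical_system.markov M \<theta> \<phi>"
    and "random_dynamical_system.synchronizing M \<phi>"
    and "random_dynamical_system.irreducible_chain M \<phi>"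
    and "random_dynamical_system.positive_recurrent_chain M \<phi>"
  shows "(\<integral>\<^sup>+ \<omega>. ennreal_of_enat
            (random_dynamical_system.synchronization_time \<phi> \<omega> x y) \<partial>M) < \<infinity>"
proof -
  interpret random_dynamical_system M \<theta> \<phi>
    by (rule assms(1))
  interpret step: random_map M "\<phi> 1"
    by (rule random_map_phi)
  show ?thesis
  proof (cases "x = y")
    case True
    then have "synchronization_time \<omega> x y \<le> 0" for \<omega>
      unfolding synchronization_time_def by (intro Inf_lower) (auto simp: zero_enat_def)
    then show ?thesis
      by simp
  next
    case False
    \<comment> \<open>The starting state \<open>x\<close> serves as the reference state
      \<open>z\<close>.\<close>
    have irr: "\<exists>n. (step.killed {} ^^ n) (indicator {w}) x > 0" for w
    proof -
      obtain n where "prob {\<omega> \<in> space M. \<phi> n \<omega> x = w} > 0"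
        using assms(4) unfolding irreducible_chain_def chain_def by blast
      \<comment> \<open>A vacuous avoidance condition with \<open>D = {}\<close> brings the free
        chain into the form of the killed iterates.\<close>
      then have "0 < emeasure M {\<omega> \<in> space M. \<phi> n \<omega> x \<in> {w} \<and> (\<forall>j\<in>{1..n}. \<phi> j \<omega> x \<notin> {})}"
        by (simp add: emeasure_eq_measure)
      then show ?thesis
        unfolding emeasure_chain_killed[OF assms(2)] by blast
    qed
    have "step.occupation {x} (\<lambda>_. 1) x < \<top>"
      using assms(5)
      unfolding positive_recurrent_chain_def return_time_integral[OF assms(2)] by simp
    then show ?thesis
      unfolding synchronization_time_integral[OF assms(2) False] infinity_ennreal_def
      by (intro step.pair_occupation_finite[OF irr] pair_survival_less_1 assms)
  qed
qed

end
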